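(* Every centrally Utumi ring is strongly $\pi$-regular.
   Context: All rings are associative with identity (not necessarily commutative). For a ring $R$, $\mathrm{Nil}(R)$ denotes the set of nilpotent elements and $C(R)$ the center. A ring $R$ is called centrally Utumi if for every $r\in R$ there exists $x\in R$ such that $r-r^2x\in \mathrm{Nil}(R)\cap C(R)$. A ring $R$ is called strongly $\pi$-regular if for every $r\in R$ there exists a positive integer $n$ such that $r^n\in r^{n+1}R\cap Rr^{n+1}$. *)

theory Defs
  imports "HOL-Algebra.Ring" "HOL-Algebra.Coset"
begin

text \<open>
  The predicates below are meant for a structure \<open>R\<close> with \<open>ring R\<close>: associative, with
  identity, not necessarily commutative; the zero ring is included.
\<close>

definition nilpotents :: "('a, 'b) ring_scheme \<Rightarrow> 'a set" where
  "nilpotents R = {a \<in> carrier R. \<exists>n::nat. n > 0 \<and> a [^]\<^bsub>R\<^esub> n = \<zero>\<^bsub>R\<^esub>}"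

definition ring_center :: "('a, 'b) ring_scheme \<Rightarrow> 'a set" where
  "ring_center R = {a \<in> carrier R. \<forall>b \<in> carrier R. a \<otimes>\<^bsub>R\<^esub> b = b \<otimes>\<^bsub>R\<^esub> a}"

definition centrally_utumi :: "('a, 'b) ring_scheme \<Rightarrow> bool" where
  "centrally_utumi R \<longleftrightarrow>
    (\<forall>r \<in> carrier R. \<exists>x \<in> carrier R.
       r \<ominus>\<^bsub>R\<^esub> (r [^]\<^bsub>R\<^esub> (2::nat)) \<otimes>\<^bsub>R\<^esub> x \<in> nilpotents R \<inter> ring_center R)"

text \<open>
  The one-sided principal ideals \<open>aR\<close> and \<open>Ra\<close> are the multiplicative cosets
  \<open>a <# carrier R\<close> and \<open>carrier R #> a\<close>.
\<close>

definition strongly_pi_regular :: "('a, 'b) ring_scheme \<Rightarrow> bool" where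
  "strongly_pi_regular R \<longleftrightarrow>
    (\<forall>r \<in> carrier R. \<exists>n::nat. n > 0 \<and>
       r [^]\<^bsub>R\<^esub> n \<in> (r [^]\<^bsub>R\<^esub> (n + 1) <#\<^bsub>R\<^esub> carrier R)
                    \<inter> (carrier R #>\<^bsub>R\<^esub> r [^]\<^bsub>R\<^esub> (n + 1)))"

end

theory Submission
  imports Defs "HOL-Algebra.Multiplicative_Group"
begin

text \<open>
  Write \<open>c = r - r\<^sup>2 x = r (1 - r x)\<close>. As \<open>c\<close> is central, \<open>c\<^sup>n = r\<^sup>n (1 - r x)\<^sup>n\<close> lies in
  \<open>r\<^sup>n - r\<^sup>n\<^sup>+\<^sup>1 R\<close>, so nilpotency of \<open>c\<close> gives \<open>r\<^sup>n \<in> r\<^sup>n\<^sup>+\<^sup>1 R\<close>, and then \<open>s = s\<^sup>2 z\<close> for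
  \<open>s = r\<^sup>n\<close> and some \<open>z\<close>. For the other side, elements of square zero are central, since
  \<open>a - a\<^sup>2 x = a\<close> when \<open>a\<^sup>2 = 0\<close>. Applied to \<open>s z s - s\<close> and then to \<open>s - z s\<^sup>2\<close>, this yields
  \<open>s\<^sup>2 = z s\<^sup>3\<close>.
\<close>

context ring
begin

text \<open>The set \<open>1 - rR\<close> is closed under multiplication:
  \<open>(1 - r u) (1 - r x) = 1 - r (x + u - u r x)\<close>.\<close>

lemma one_minus_pow:
  assumes "r \<in> carrier R" "x \<in> carrier R"
  shows "\<exists>u \<in> carrier R. (\<one> \<ominus> r \<otimes> x) [^] (k::nat) = \<one> \<ominus> r \<otimes> u"
proof (induction k)
  case 0
  show ?case
    using assms by (intro bexI[of _ \<zero>]) (auto simp: minus_eq)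
next
  case (Suc k)
  then obtain u where u: "u \<in> carrier R" "(\<one> \<ominus> r \<otimes> x) [^] k = \<one> \<ominus> r \<otimes> u"
    by blast
  have "(\<one> \<ominus> r \<otimes> x) [^] Suc k = \<one> \<ominus> r \<otimes> (x \<oplus> u \<ominus> u \<otimes> (r \<otimes> x))"
    using assms u by (simp add: ring_simprules)
  then show ?case
    using assms u by (intro bexI[of _ "x \<oplus> u \<ominus> u \<otimes> (r \<otimes> x)"]) auto
qed

text \<open>The factors \<open>r\<close> and \<open>w\<close> need not commute with each other;
  moving the whole product \<open>r \<otimes> w\<close> past \<open>w [^] k\<close> is
  enough.\<close>

lemma central_mult_pow:
  assumes "r \<in> carrier R" "w \<in> carrier R" "r \<otimes> w \<in> ring_center R"
  shows "(r \<otimes> w) [^] (k::nat) = r [^] k \<otimes> w [^] k"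
proof (induction k)
  case 0
  show ?case by simp
next
  case (Suc k)
  have "(r \<otimes> w) [^] Suc k = r [^] k \<otimes> (w [^] k \<otimes> (r \<otimes> w))"
    using Suc assms by (simp add: m_assoc)
  also have "w [^] k \<otimes> (r \<otimes> w) = r \<otimes> w \<otimes> w [^] k"
    using assms by (simp add: ring_center_def)
  also have "r [^] k \<otimes> (r \<otimes> w \<otimes> w [^] k) = r [^] Suc k \<otimes> w [^] Suc k"
    using assms nat_pow_Suc2[of w k] by (simp add: m_assoc)
  finally show ?case .
qed

text \<open>Multiplying the hypothesis on the left by \<open>r [^] k\<close> trades
  \<open>r [^] (n + k)\<close> for \<open>r [^] (n + Suc k) \<otimes> y\<close>, so each step
  collects one more \<open>y\<close> on the right.\<close>

lemma pow_absorb: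
  assumes "r \<in> carrier R" "y \<in> carrier R" "r [^] (n::nat) = r [^] (n + 1) \<otimes> y"
  shows "r [^] n = r [^] (n + k) \<otimes> y [^] (k::nat)"
proof (induction k)
  case 0
  show ?case using assms by simp
next
  case (Suc k)
  have "r [^] (n + k) = r [^] k \<otimes> r [^] n"
    using assms(1) by (simp add: nat_pow_mult add.commute)
  also have "\<dots> = r [^] k \<otimes> (r [^] (n + 1) \<otimes> y)"
    using assms(3) by simp
  also have "\<dots> = r [^] (n + Suc k) \<otimes> y"
    using assms(1,2) nat_pow_mult[of r k "n + 1"] by (simp add: m_assoc[symmetric] ac_simps)
  finally have "r [^] n = r [^] (n + Suc k) \<otimes> y \<otimes> y [^] k"
    using Suc by simp
  then show ?case
    using assms(1,2) nat_pow_Suc2[of y k] by (simp add: m_assoc)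
qed

lemma centrally_utumi_right_pi_regular:
  assumes "centrally_utumi R" "r \<in> carrier R"
  shows "\<exists>n::nat. n > 0 \<and> (\<exists>y \<in> carrier R. r [^] n = r [^] (n + 1) \<otimes> y)"
proof -
  obtain x where x: "x \<in> carrier R" and c: "r \<ominus> r [^] (2::nat) \<otimes> x \<in> nilpotents R \<inter> ring_center R"
    using assms by (auto simp: centrally_utumi_def)
  define w where "w = \<one> \<ominus> r \<otimes> x"
  have w: "w \<in> carrier R"
    using assms x by (simp add: w_def)
  have "r \<ominus> r [^] (2::nat) \<otimes> x = r \<otimes> w"
    using assms(2) x by (simp add: w_def numeral_2_eq_2 ring_simprules)
  with c obtain n :: nat where n: "n > 0" "(r \<otimes> w) [^] n = \<zero>" "r \<otimes> w \<in> ring_center R"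
    by (auto simp: nilpotents_def)
  obtain u where u: "u \<in> carrier R" "w [^] n = \<one> \<ominus> r \<otimes> u"
    using one_minus_pow[OF assms(2) x] unfolding w_def by blast
  have "r [^] n \<ominus> r [^] (n + 1) \<otimes> u = r [^] n \<otimes> w [^] n"
    using assms(2) u by (simp add: ring_simprules)
  also have "\<dots> = \<zero>"
    using central_mult_pow[OF assms(2) w n(3)] n(2) by simp
  finally have "r [^] n = r [^] (n + 1) \<otimes> u"
    using assms(2) u(1) by (subst (asm) r_right_minus_eq) auto
  with n(1) u(1) show ?thesis by blast
qed

lemma centrally_utumi_square_zero_central:
  assumes "centrally_utumi R" "a \<in> carrier R" "a \<otimes> a = \<zero>"
  shows "a \<in> ring_center R"
proof -
  obtain x where "x \<in> carrier R" "a \<ominus> a [^] (2::nat) \<otimes> x \<in> ring_center R"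
    using assms by (auto simp: centrally_utumi_def)
  then show ?thesis
    using assms by (simp add: numeral_2_eq_2 minus_eq)
qed

lemma centrally_utumi_left_regular:
  assumes "centrally_utumi R" and s: "s \<in> carrier R" and z: "z \<in> carrier R"
    and eq: "s = s \<otimes> s \<otimes> z"
  shows "s \<otimes> s = z \<otimes> (s \<otimes> s \<otimes> s)"
proof -
  have ssz: "s \<otimes> (s \<otimes> z) = s"
    using eq s z by (simp add: m_assoc)
  \<comment> \<open>The same cancellation with a trailing factor, as it occurs inside right-nested
    products.\<close>
  have ssz': "s \<otimes> (s \<otimes> (z \<otimes> v)) = s \<otimes> v" if "v \<in> carrier R" for v
    using ssz s z that by (metis m_assoc m_closed)
  define a where "a = s \<otimes> z \<otimes> s \<ominus> s"
  have a: "a \<in> carrier R"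
    using s z by (simp add: a_def)
  have sa: "s \<otimes> a = \<zero>"
    using s z by (simp add: a_def minus_eq r_distr r_minus m_assoc ssz' r_neg)
  \<comment> \<open>Since \<open>a = (s z - 1) s\<close>, the square of \<open>a\<close> is a left
    multiple of \<open>s a = 0\<close>.\<close>
  have "a \<otimes> a = s \<otimes> z \<otimes> (s \<otimes> a) \<ominus> s \<otimes> a"
    using s z a by (subst (1) a_def) (simp add: minus_eq l_distr l_minus m_assoc)
  then have "a \<otimes> a = \<zero>"
    using s z by (simp add: sa minus_eq)
  then have "a \<in> ring_center R"
    by (rule centrally_utumi_square_zero_central[OF assms(1) a])
  \<comment> \<open>Centrality is what changes sides: it turns \<open>s a = 0\<close> into
    \<open>a s = 0\<close>.\<close>
  then have "a \<otimes> s = \<zero>"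
    using s sa by (simp add: ring_center_def)
  then have "s \<otimes> z \<otimes> s \<otimes> s \<ominus> s \<otimes> s = \<zero>"
    using s z by (simp add: a_def minus_eq l_distr l_minus)
  then have szss: "s \<otimes> (z \<otimes> (s \<otimes> s)) = s \<otimes> s"
    using s z by (simp add: m_assoc)
  \<comment> \<open>The same pattern with \<open>b = (1 - z s) s\<close>. It ends in
    \<open>b s = 0\<close> rather than \<open>b = 0\<close>, hence a relation for the square of
    \<open>s\<close>.\<close>
  define b where "b = s \<ominus> z \<otimes> (s \<otimes> s)"
  have b: "b \<in> carrier R"
    using s z by (simp add: b_def)
  have sb: "s \<otimes> b = \<zero>"
    using s z by (simp add: b_def minus_eq r_distr r_minus szss r_neg)
  have "b \<otimes> b = s \<otimes> b \<ominus> z \<otimes> (s \<otimes> (s \<otimes> b))"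
    using s z b by (subst (1) b_def) (simp add: minus_eq l_distr l_minus m_assoc)
  then have "b \<otimes> b = \<zero>"
    using s z by (simp add: sb minus_eq)
  then have "b \<in> ring_center R"
    by (rule centrally_utumi_square_zero_central[OF assms(1) b])
  then have "b \<otimes> s = \<zero>"
    using s sb by (simp add: ring_center_def)
  then have "s \<otimes> s \<ominus> z \<otimes> (s \<otimes> s \<otimes> s) = \<zero>"
    using s z by (simp add: b_def minus_eq l_distr l_minus m_assoc)
  then show ?thesis
    using s z by simp
qed

lemma centrally_utumi_pi_regular:
  assumes "centrally_utumi R" and r: "r \<in> carrier R"
  shows "\<exists>n::nat. n > 0 \<and> r [^] n \<in> (r [^] (n + 1) <# carrier R) \<inter> (carrier R #> r [^] (n + 1))"
proof -
  obtain n :: nat and y where n: "n > 0" and y: "y \<in> carrier R"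
    and eq: "r [^] n = r [^] (n + 1) \<otimes> y"
    using centrally_utumi_right_pi_regular[OF assms] by blast
  define z where "z = y [^] n"
  have z: "z \<in> carrier R"
    using y by (simp add: z_def)
  have "r [^] n = r [^] n \<otimes> r [^] n \<otimes> z"
    unfolding z_def nat_pow_mult[OF r] by (rule pow_absorb[OF r y eq])
  then have "r [^] n \<otimes> r [^] n = z \<otimes> (r [^] n \<otimes> r [^] n \<otimes> r [^] n)"
    by (intro centrally_utumi_left_regular) (use assms z in auto)
  \<comment> \<open>The exponent \<open>3 n\<close> is split so that
    \<open>r [^] (2 * n + 1)\<close> stands last; \<open>n > 0\<close> makes the natural subtraction
    exact.\<close>
  then have "r [^] (2 * n) = z \<otimes> r [^] ((n - 1) + (2 * n + 1))"
    using r n by (simp add: nat_pow_mult mult_2 add.assoc)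
  also have "\<dots> = z \<otimes> r [^] (n - 1) \<otimes> r [^] (2 * n + 1)"
    unfolding nat_pow_mult[OF r, of "n - 1" "2 * n + 1", symmetric] using r z by (simp add: m_assoc)
  finally have left: "r [^] (2 * n) = z \<otimes> r [^] (n - 1) \<otimes> r [^] (2 * n + 1)" .
  have "r [^] (2 * n) = r [^] n \<otimes> r [^] n"
    using r by (simp add: nat_pow_mult mult_2)
  also have "\<dots> = r [^] n \<otimes> (r [^] (n + 1) \<otimes> y)"
    using eq by simp
  also have "\<dots> = r [^] n \<otimes> r [^] (n + 1) \<otimes> y"
    using r y by (simp add: m_assoc)
  also have "\<dots> = r [^] (2 * n + 1) \<otimes> y"
    by (simp only: nat_pow_mult[OF r] mult_2 add.assoc)
  finally have right: "r [^] (2 * n) = r [^] (2 * n + 1) \<otimes> y" .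
  have "r [^] (2 * n) \<in> r [^] (2 * n + 1) <# carrier R"
    unfolding l_coset_def using right y by blast
  moreover have "r [^] (2 * n) \<in> carrier R #> r [^] (2 * n + 1)"
    unfolding r_coset_def using left z r m_closed nat_pow_closed by blast
  \<comment> \<open>The exponent is \<open>2 * n\<close> because the left-hand relation was obtained
    only for the square of \<open>r [^] n\<close>.\<close>
  ultimately show ?thesis
    using n by (intro exI[of _ "2 * n"]) simp
qed

end

theorem theorem2p14:
  fixes R :: "('a, 'b) ring_scheme"
  assumes "ring R"
    and "centrally_utumi R"
  shows "strongly_pi_regular R"
  unfolding strongly_pi_regular_def
  using ring.centrally_utumi_pi_regular[OF assms] by blast

end
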